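(* Let $\mathfrak p=(\bar{\mathfrak s}_1,\bar{\mathfrak s}_2)\in\mathcal L_2$. Then there exists a genus 2 curve $C_{\bar{\mathfrak s}_1,\bar{\mathfrak s}_2}$ representing $\mathfrak p$ with equation $$Y^2=a_0X^6+a_1X^5+a_2X^4+a_3X^3+t\,a_2X^2+t^2a_1X+t^3a_0,$$ where $$\begin{aligned} t&=\bar{\mathfrak s}_2^2-4\bar{\mathfrak s}_1^3,\\ a_0&=\bar{\mathfrak s}_2^2+\bar{\mathfrak s}_1^2\bar{\mathfrak s}_2-2\bar{\mathfrak s}_1^3,\\ a_1&=2(\bar{\mathfrak s}_1^2+3\bar{\mathfrak s}_2)(\bar{\mathfrak s}_2^2-4\bar{\mathfrak s}_1^3),\\ a_2&=(15\bar{\mathfrak s}_2^2-\bar{\mathfrak s}_1^2\bar{\mathfrak s}_2-30\bar{\mathfrak s}_1^3)(\bar{\mathfrak s}_2^2-4\bar{\mathfrak s}_1^3),\\ a_3&=4(5\bar{\mathfrak s}_2-\bar{\mathfrak s}_1^2)(\bar{\mathfrak s}_2^2-4\bar{\mathfrak s}_1^3)^2.\end{aligned}$$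
   Context: Curves are over $\mathbb C$. $\mathcal L_2$ is the locus in the moduli space $\mathcal M_2$ of genus 2 curves $C$ having a degree 2 covering to an elliptic curve (equivalently, having a non-hyperelliptic involution). Every such curve is isomorphic to one of the form $Y^2=X^6-aX^4+bX^2-1$ with $27-18ab-a^2b^2+4a^3+4b^3\neq0$; its $\mathfrak s$-invariants are $\mathfrak s_1=ab$ and $\mathfrak s_2=a^3+b^3$. The ordered pair $(\mathfrak s_1,\mathfrak s_2)$ determines the isomorphism class of the curve, and $\mathfrak p=(\bar{\mathfrak s}_1,\bar{\mathfrak s}_2)\in\mathcal L_2$ denotes the point of $\mathcal L_2$ with these $\mathfrak s$-invariants. "$C$ represents $\mathfrak p$" means that the isomorphism class $[C]$ equals $\mathfrak p$.
   Formalization: The formal statement additionally assumes s̄₁ ≠ 0 and t = s̄₂² − 4s̄₁³ ≠ 0; otherwise the displayed equation is Y² = a₀X⁶ (t = 0) or Y² = s̄₂²(X + s̄₂)⁶ (s̄₁ = 0), which never defines a genus 2 curve. *)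

theory Defs
  imports
    "HOL-Algebra.Embedded_Algebras"
    "HOL-Computational_Algebra.Polynomial"
    "HOL-Computational_Algebra.Fraction_Field"
    Complex_Main
begin

text \<open>
  A polynomial \<open>f\<close> stands for the smooth projective curve with affine equation \<open>Y\<^sup>2 = f(X)\<close>.
  Nonconstant morphisms between such curves are given by the homomorphisms, in the opposite
  direction, of their function fields over the complex numbers.
\<close>

text \<open>
  The function field \<open>\<complex>(X)[Y] / (Y\<^sup>2 - f)\<close>; the pair \<open>(u, v)\<close> stands for \<open>u + v Y\<close>.
\<close>

type_synonym ff_elem = "complex poly fract \<times> complex poly fract"

definition function_field :: "complex poly \<Rightarrow> ff_elem ring" where
  "function_field f =
     \<lparr> carrier = UNIV,
       monoid.mult = (\<lambda>(u, v) (u', v'). (u * u' + Fract f 1 * (v * v'), u * v' + v * u')),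
       monoid.one = (1, 0),
       ring.zero = (0, 0),
       ring.add = (\<lambda>(u, v) (u', v'). (u + u', v + v')) \<rparr>"

definition ff_const :: "complex \<Rightarrow> ff_elem" where
  "ff_const c = (Fract [:c:] 1, 0)"

definition curve_iso :: "complex poly \<Rightarrow> complex poly \<Rightarrow> bool" where
  "curve_iso f g \<longleftrightarrow>
     (\<exists>\<phi> \<in> ring_iso (function_field f) (function_field g). \<forall>c. \<phi> (ff_const c) = ff_const c)"

text \<open>
  A covering of degree \<open>n\<close> from the curve of \<open>f\<close> to the curve of \<open>e\<close> embeds the function field
  of \<open>e\<close> as a subfield over which the function field of \<open>f\<close> has dimension \<open>n\<close>.
\<close>

definition has_covering :: "nat \<Rightarrow> complex poly \<Rightarrow> complex poly \<Rightarrow> bool" where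
  "has_covering n f e \<longleftrightarrow>
     (\<exists>\<phi> \<in> ring_hom (function_field e) (function_field f).
        (\<forall>c. \<phi> (ff_const c) = ff_const c) \<and>
        ring.dimension (function_field f) n
          (\<phi> ` carrier (function_field e)) (carrier (function_field f)))"

definition elliptic_curve :: "complex poly \<Rightarrow> bool" where
  "elliptic_curve e \<longleftrightarrow> Polynomial.degree e = 3 \<and> rsquarefree e"

text \<open>In degree 5 one of the six branch points lies at infinity.\<close>

definition genus2_curve :: "complex poly \<Rightarrow> bool" where
  "genus2_curve f \<longleftrightarrow> Polynomial.degree f \<in> {5, 6} \<and> rsquarefree f"

definition iso_class :: "complex poly \<Rightarrow> complex poly set" where
  "iso_class f = {g. genus2_curve g \<and> curve_iso f g}"

text \<open>
  The points of the moduli space are the isomorphism classes. Every complex genus 2 curve has an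
  equation \<open>Y\<^sup>2 = f(X)\<close>, so no class is missing.
\<close>

definition moduli_M2 :: "complex poly set set" where
  "moduli_M2 = iso_class ` {f. genus2_curve f}"

definition represents :: "complex poly \<Rightarrow> complex poly set \<Rightarrow> bool" where
  "represents f p \<longleftrightarrow> genus2_curve f \<and> iso_class f = p"

definition locus_L2 :: "complex poly set set" where
  "locus_L2 = {p \<in> moduli_M2. \<exists>f e. represents f p \<and> elliptic_curve e \<and> has_covering 2 f e}"

definition even_sextic :: "complex \<Rightarrow> complex \<Rightarrow> complex poly" where
  "even_sextic a b = [:-1, 0, b, 0, -a, 0, 1:]"

definition has_s_invariants :: "complex poly set \<Rightarrow> complex \<Rightarrow> complex \<Rightarrow> bool" where
  "has_s_invariants p s1 s2 \<longleftrightarrow>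
     (\<exists>a b. 27 - 18 * a * b - a^2 * b^2 + 4 * a^3 + 4 * b^3 \<noteq> 0 \<and>
            represents (even_sextic a b) p \<and> s1 = a * b \<and> s2 = a^3 + b^3)"

end

theory Submission
  imports Defs "HOL-Computational_Algebra.Fundamental_Theorem_Algebra"
begin

text \<open>
  Write \<open>p\<close> as the class of \<open>Y\<^sup>2 = f(X)\<close> with \<open>f = X\<^sup>6 - a X\<^sup>4 + b X\<^sup>2 - 1\<close>, and put
  \<open>r = a\<^sup>3 - b\<^sup>3\<close>, so that \<open>t = r\<^sup>2\<close>. The involution \<open>X \<mapsto> - X\<close> has fixed points \<open>0\<close> and \<open>\<infinity>\<close>; the
  substitution \<open>X = \<i> a (x + r) / (b (x - r))\<close> moves them to \<open>- r\<close> and \<open>r\<close>, which are the fixed points of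
  \<open>x \<mapsto> t / x\<close>. Since \<open>(\<i> a / b)\<^sup>2 = - a\<^sup>2 / b\<^sup>2\<close>, clearing denominators leaves a sextic whose
  coefficients are symmetric in \<open>a\<close> and \<open>b\<close>, and these are the stated polynomials in \<open>s\<^sub>1\<close> and \<open>s\<^sub>2\<close>.
  The hypotheses \<open>s\<^sub>1 \<noteq> 0\<close> and \<open>t \<noteq> 0\<close> say that the substitution is defined and invertible.
\<close>

section \<open>Substitution homomorphisms of the rational function field\<close>

definition cfract :: "complex \<Rightarrow> complex poly fract" where
  "cfract c = Fract [:c:] 1"

lemma ff_const_cfract: "ff_const c = (cfract c, 0)"
  by (simp add: ff_const_def cfract_def)

lemma cfract_hom [simp]:
  "cfract 0 = 0" "cfract 1 = 1"
  "cfract (c + d) = cfract c + cfract d" "cfract (- c) = - cfract c"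
  "cfract (c - d) = cfract c - cfract d" "cfract (c * d) = cfract c * cfract d"
  "cfract (c ^ n) = cfract c ^ n"
proof -
  show 0: "cfract 0 = 0" and 1: "cfract 1 = 1"
    by (simp_all add: cfract_def Zero_fract_def One_fract_def one_pCons)
  show "cfract (c + d) = cfract c + cfract d" "cfract (- c) = - cfract c"
    "cfract (c - d) = cfract c - cfract d"
    by (simp_all add: cfract_def)
  have mult: "cfract (c * d) = cfract c * cfract d" for c d
    by (simp add: cfract_def mult.commute)
  then show "cfract (c * d) = cfract c * cfract d" .
  show "cfract (c ^ n) = cfract c ^ n"
    by (induction n) (simp_all add: 1 mult)
qed

lemma cfract_numeral [simp]: "cfract (numeral n) = numeral n"
proof -
  have "cfract (of_nat m) = of_nat m" for m
    by (induction m) simp_all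
  from this[of "numeral n"] show ?thesis by simp
qed

lemma cfract_eq_iff [simp]: "cfract c = cfract d \<longleftrightarrow> c = d"
  by (simp add: cfract_def eq_fract)

lemma cfract_eq_0_iff [simp]: "cfract c = 0 \<longleftrightarrow> c = 0"
  using cfract_eq_iff[of c 0] by (simp del: cfract_eq_iff)

definition fract_X :: "complex poly fract" where
  "fract_X = Fract [:0, 1:] 1"

definition eval_fract :: "complex poly fract \<Rightarrow> complex poly \<Rightarrow> complex poly fract" where
  "eval_fract y P = poly (map_poly cfract P) y"

lemma eval_fract_0 [simp]: "eval_fract y 0 = 0"
  by (simp add: eval_fract_def)

lemma eval_fract_pCons [simp]: "eval_fract y (pCons c P) = cfract c + y * eval_fract y P"
  by (simp add: eval_fract_def map_poly_pCons)

lemma eval_fract_1 [simp]: "eval_fract y 1 = 1"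
  by (simp add: one_pCons)

lemma eval_fract_add [simp]: "eval_fract y (P + Q) = eval_fract y P + eval_fract y Q"
  by (induction P Q rule: poly_induct2) (simp_all add: algebra_simps)

lemma eval_fract_smult [simp]: "eval_fract y (smult c P) = cfract c * eval_fract y P"
  by (induction P) (simp_all add: algebra_simps)

lemma eval_fract_mult [simp]: "eval_fract y (P * Q) = eval_fract y P * eval_fract y Q"
  by (induction P) (simp_all add: algebra_simps)

lemma eval_fract_X [simp]: "eval_fract fract_X P = Fract P 1"
  by (induction P) (simp_all add: Zero_fract_def cfract_def fract_X_def)

text \<open>Since the complex numbers are algebraically closed, a nonconstant \<open>y\<close> is
  transcendental: each root \<open>z\<close> of \<open>P\<close> splits off a factor
  \<open>y - cfract z\<close>, which is nonzero, and the degree drops.\<close>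

lemma eval_fract_eq_0_iff:
  assumes "y \<notin> range cfract"
  shows "eval_fract y P = 0 \<longleftrightarrow> P = 0"
proof -
  have "eval_fract y P \<noteq> 0" if "P \<noteq> 0"
    using that
  proof (induction "degree P" arbitrary: P rule: less_induct)
    case less
    show ?case
    proof (cases "degree P = 0")
      case True
      then obtain c where "P = [:c:]" by (rule degree_eq_zeroE)
      with less.prems show ?thesis by simp
    next
      case False
      then have "\<not> constant (poly P)" by (simp add: constant_degree)
      then obtain z where "poly P z = 0"
        using fundamental_theorem_of_algebra by blast
      then obtain Q where PQ: "P = [:- z, 1:] * Q"
        by (metis poly_eq_0_iff_dvd dvdE)
      with less.prems have "Q \<noteq> 0" by auto
      with PQ have "degree Q < degree P" by (simp add: degree_mult_eq del: mult_pCons_left)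
      with less.hyps \<open>Q \<noteq> 0\<close> have "eval_fract y Q \<noteq> 0" by blast
      moreover have "y - cfract z \<noteq> 0" using assms by auto
      moreover have "eval_fract y P = (y - cfract z) * eval_fract y Q"
        unfolding PQ eval_fract_mult by simp
      ultimately show ?thesis by simp
    qed
  qed
  then show ?thesis by auto
qed

text \<open>Meaningful for nonconstant \<open>y\<close> only, when nonzero denominators stay nonzero.\<close>

definition fract_subst :: "complex poly fract \<Rightarrow> complex poly fract \<Rightarrow> complex poly fract" where
  "fract_subst y q =
     (THE z. \<exists>P Q. Q \<noteq> 0 \<and> q = Fract P Q \<and> z = eval_fract y P / eval_fract y Q)"

context
  fixes y :: "complex poly fract"
  assumes y: "y \<notin> range cfract"
begin

text \<open>Well-definedness: two representations of one fraction are related by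
  cross-multiplication, evaluation at \<open>y\<close> preserves that equation, and the denominators
  stay nonzero.\<close>

lemma fract_subst_Fract:
  assumes "Q \<noteq> 0"
  shows "fract_subst y (Fract P Q) = eval_fract y P / eval_fract y Q"
  unfolding fract_subst_def
proof (rule the_equality)
  fix z
  assume "\<exists>P' Q'. Q' \<noteq> 0 \<and> Fract P Q = Fract P' Q' \<and> z = eval_fract y P' / eval_fract y Q'"
  then obtain P' Q' where *: "Q' \<noteq> 0" "Fract P Q = Fract P' Q'"
    "z = eval_fract y P' / eval_fract y Q'" by blast
  with assms have "P * Q' = P' * Q" by (simp add: eq_fract)
  then have "eval_fract y P * eval_fract y Q' = eval_fract y P' * eval_fract y Q"
    by (metis eval_fract_mult)
  with * assms show "z = eval_fract y P / eval_fract y Q"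
    by (simp add: frac_eq_eq eval_fract_eq_0_iff[OF y])
qed (use assms in blast)

lemma fract_subst_add: "fract_subst y (u + v) = fract_subst y u + fract_subst y v"
  by (cases u; cases v)
    (simp add: fract_subst_Fract eval_fract_eq_0_iff[OF y] add_frac_eq)

lemma fract_subst_mult: "fract_subst y (u * v) = fract_subst y u * fract_subst y v"
  by (cases u; cases v) (simp add: fract_subst_Fract)

lemma fract_subst_poly: "fract_subst y (Fract P 1) = eval_fract y P"
  by (simp add: fract_subst_Fract)

lemma fract_subst_cfract: "fract_subst y (cfract c) = cfract c"
  by (simp add: cfract_def fract_subst_poly)

lemma fract_subst_X: "fract_subst y fract_X = y"
  by (simp add: fract_X_def fract_subst_poly)

lemma fract_subst_0: "fract_subst y 0 = 0"
  using fract_subst_cfract[of 0] by simp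

lemma fract_subst_1: "fract_subst y 1 = 1"
  using fract_subst_cfract[of 1] by simp

lemma fract_subst_minus: "fract_subst y (- u) = - fract_subst y u"
  using fract_subst_add[of u "- u"] by (simp add: fract_subst_0 eq_neg_iff_add_eq_0 add.commute)

lemma fract_subst_diff: "fract_subst y (u - v) = fract_subst y u - fract_subst y v"
  using fract_subst_add[of u "- v"] by (simp add: fract_subst_minus)

lemma fract_subst_eq_0_iff: "fract_subst y u = 0 \<longleftrightarrow> u = 0"
proof (cases "u = 0")
  case False
  then have "fract_subst y u * fract_subst y (inverse u) = 1"
    by (simp flip: fract_subst_mult add: fract_subst_1)
  with False show ?thesis by auto
qed (simp add: fract_subst_0)

lemma fract_subst_divide: "fract_subst y (u / v) = fract_subst y u / fract_subst y v"
proof (cases "v = 0")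
  case False
  then have "fract_subst y (u / v) * fract_subst y v = fract_subst y u"
    by (simp flip: fract_subst_mult)
  with False show ?thesis by (simp add: field_simps fract_subst_eq_0_iff)
qed (simp add: fract_subst_0)

end

text \<open>The composition respects the field operations and fixes the constants and
  \<open>fract_X\<close>, which generate the field.\<close>

lemma fract_subst_inverse:
  assumes y: "y \<notin> range cfract" and y': "y' \<notin> range cfract"
    and inv: "fract_subst y y' = fract_X"
  shows "fract_subst y (fract_subst y' q) = q"
proof (cases q)
  case (Fract P Q)
  have ev: "fract_subst y (eval_fract y' R) = Fract R 1" for R
  proof -
    have "fract_subst y (eval_fract y' R) = eval_fract fract_X R"
      by (induction R)
        (simp_all add: fract_subst_0[OF y] fract_subst_add[OF y] fract_subst_mult[OF y]
          fract_subst_cfract[OF y] inv del: eval_fract_X)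
    then show ?thesis by simp
  qed
  from Fract show ?thesis
    by (simp add: fract_subst_Fract[OF y'] fract_subst_divide[OF y] ev)
qed

section \<open>Isomorphisms of hyperelliptic function fields\<close>

text \<open>Extends \<open>\<sigma>\<close> by Y \<mapsto> \<open>w\<close> Y. The condition on
  \<open>w\<close> says that the image of Y squares to the image of \<open>f\<close>, and
  \<open>w \<noteq> 0\<close> keeps the extension bijective.\<close>

lemma curve_isoI:
  assumes "bij \<sigma>"
    and add: "\<And>u v. \<sigma> (u + v) = \<sigma> u + \<sigma> v" and mult: "\<And>u v. \<sigma> (u * v) = \<sigma> u * \<sigma> v"
    and const: "\<And>c. \<sigma> (cfract c) = cfract c"
    and "w \<noteq> 0" and w: "\<sigma> (Fract f 1) = w ^ 2 * Fract g 1"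
  shows "curve_iso f g"
proof -
  define \<phi> :: "ff_elem \<Rightarrow> ff_elem" where "\<phi> = (\<lambda>(u, v). (\<sigma> u, \<sigma> v * w))"
  have \<sigma>01: "\<sigma> 0 = 0" "\<sigma> 1 = 1" using const[of 0] const[of 1] by simp_all
  have "inj \<phi>"
    using bij_is_inj[OF \<open>bij \<sigma>\<close>] \<open>w \<noteq> 0\<close> by (auto simp: inj_def \<phi>_def)
  moreover have "surj \<phi>"
  proof (rule surjI)
    fix z
    show "\<phi> (case z of (u, v) \<Rightarrow> (inv_into UNIV \<sigma> u, inv_into UNIV \<sigma> (v / w))) = z"
      using bij_is_surj[OF \<open>bij \<sigma>\<close>] \<open>w \<noteq> 0\<close> by (simp add: \<phi>_def surj_f_inv_f split: prod.split)
  qed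
  ultimately have "bij \<phi>" by (simp add: bij_def)
  then have "\<phi> \<in> ring_iso (function_field f) (function_field g)"
    unfolding ring_iso_def ring_hom_def
    by (auto simp: function_field_def \<phi>_def add mult w \<sigma>01 algebra_simps power2_eq_square)
  moreover have "\<phi> (ff_const c) = ff_const c" for c
    by (simp add: \<phi>_def ff_const_cfract const \<sigma>01)
  ultimately show ?thesis unfolding curve_iso_def by blast
qed

lemma curve_iso_sym:
  assumes "curve_iso f g" shows "curve_iso g f"
proof -
  let ?F = "function_field f" and ?G = "function_field g"
  obtain \<phi> where \<phi>: "\<phi> \<in> ring_iso ?F ?G" and const: "\<And>c. \<phi> (ff_const c) = ff_const c"
    using assms unfolding curve_iso_def by blast
  have UNIV: "carrier (function_field h) = UNIV" for h by (simp add: function_field_def)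
  have "bij \<phi>" using \<phi> by (simp add: ring_iso_def UNIV)
  then have inv: "inv_into UNIV \<phi> v = u \<longleftrightarrow> v = \<phi> u" for u v
    by (metis bij_inv_eq_iff)
  have hom: "\<phi> (u \<otimes>\<^bsub>?F\<^esub> v) = \<phi> u \<otimes>\<^bsub>?G\<^esub> \<phi> v" "\<phi> (u \<oplus>\<^bsub>?F\<^esub> v) = \<phi> u \<oplus>\<^bsub>?G\<^esub> \<phi> v"
    "\<phi> \<one>\<^bsub>?F\<^esub> = \<one>\<^bsub>?G\<^esub>" for u v
    using \<phi> by (simp_all add: ring_iso_def ring_hom_def UNIV del: split_paired_All)
  have \<phi>_inv: "\<phi> (inv_into UNIV \<phi> u) = u" for u
    using inv by metis
  have "inv_into UNIV \<phi> \<in> ring_iso ?G ?F"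
    using bij_imp_bij_inv[OF \<open>bij \<phi>\<close>]
    by (simp add: ring_iso_def ring_hom_def UNIV inv hom \<phi>_inv)
  moreover have "inv_into UNIV \<phi> (ff_const c) = ff_const c" for c
    by (simp add: inv const)
  ultimately show ?thesis unfolding curve_iso_def by blast
qed

lemma curve_iso_trans:
  assumes "curve_iso f g" "curve_iso g h" shows "curve_iso f h"
proof -
  obtain \<phi> \<psi> where "\<phi> \<in> ring_iso (function_field f) (function_field g)"
    "\<psi> \<in> ring_iso (function_field g) (function_field h)"
    and const: "\<And>c. \<phi> (ff_const c) = ff_const c" "\<And>c. \<psi> (ff_const c) = ff_const c"
    using assms unfolding curve_iso_def by blast
  then have "\<psi> \<circ> \<phi> \<in> ring_iso (function_field f) (function_field h)"
    by (intro ring_iso_set_trans)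
  moreover have "(\<psi> \<circ> \<phi>) (ff_const c) = ff_const c" for c by (simp add: const)
  ultimately show ?thesis unfolding curve_iso_def by blast
qed

lemma iso_class_cong:
  assumes "curve_iso f g" shows "iso_class f = iso_class g"
  using assms curve_iso_sym curve_iso_trans unfolding iso_class_def by blast

text \<open>A constant value \<open>e\<close> would make the numerator \<open>e\<close> times the
  denominator, forcing the determinant to vanish.\<close>

lemma fract_X_moebius_nonconst:
  assumes "c * s \<noteq> d * r"
  shows "(cfract c * fract_X + cfract r) / (cfract d * fract_X + cfract s) \<notin> range cfract"
proof
  assume "(cfract c * fract_X + cfract r) / (cfract d * fract_X + cfract s) \<in> range cfract"
  then obtain e where e: "(cfract c * fract_X + cfract r) / (cfract d * fract_X + cfract s) = cfract e"
    by auto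
  have "[:s, d:] \<noteq> 0" using assms by auto
  then have "cfract d * fract_X + cfract s \<noteq> 0"
    by (simp add: cfract_def fract_X_def Zero_fract_def eq_fract)
  with e have "cfract c * fract_X + cfract r = cfract e * (cfract d * fract_X + cfract s)"
    by (simp add: field_simps)
  then have "[:r, c:] = [:e * s, e * d:]"
    by (simp add: cfract_def fract_X_def eq_fract)
  with assms show False by simp
qed

text \<open>A Moebius map is an automorphism of the line, so it lifts to the curves once it carries
  \<open>f\<close> to \<open>g\<close> up to a square.\<close>

lemma curve_iso_moebius:
  fixes c d r s :: complex
  defines "y \<equiv> (cfract c * fract_X + cfract r) / (cfract d * fract_X + cfract s)"
  assumes det: "c * s \<noteq> d * r"
    and "w \<noteq> 0" and w: "eval_fract y f = w ^ 2 * Fract g 1"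
  shows "curve_iso f g"
proof -
  \<comment> \<open>The adjugate matrix gives the inverse Moebius map; in both compositions below
    the determinant cancels.\<close>
  define y' where "y' = (cfract s * fract_X + cfract (- r)) / (cfract (- d) * fract_X + cfract c)"
  have nc: "y \<notin> range cfract" "y' \<notin> range cfract"
    unfolding y_def y'_def using det by (intro fract_X_moebius_nonconst; simp add: mult.commute)+
  have ndet: "cfract c * cfract s - cfract d * cfract r \<noteq> 0"
    using det by (metis cfract_eq_iff cfract_hom(6) right_minus_eq)
  have nz: "cfract d * fract_X + cfract s \<noteq> 0" "cfract c - cfract d * fract_X \<noteq> 0"
    using det by (auto simp: cfract_def fract_X_def Zero_fract_def eq_fract)
  have "fract_subst y y' = (cfract s * y - cfract r) / (cfract c - cfract d * y)"
    by (simp add: y'_def fract_subst_divide fract_subst_add fract_subst_mult fract_subst_diff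
        fract_subst_minus fract_subst_cfract fract_subst_X nc)
  also have "cfract s * y - cfract r = cfract (c * s - d * r) * fract_X / (cfract d * fract_X + cfract s)"
    using nz by (simp add: y_def field_simps)
  also have "cfract c - cfract d * y = cfract (c * s - d * r) / (cfract d * fract_X + cfract s)"
    using nz by (simp add: y_def field_simps)
  finally have 1: "fract_subst y y' = fract_X" using nz ndet by simp
  have "fract_subst y' y = (cfract c * y' + cfract r) / (cfract d * y' + cfract s)"
    by (simp add: y_def fract_subst_divide fract_subst_add fract_subst_mult fract_subst_diff
        fract_subst_minus fract_subst_cfract fract_subst_X nc)
  also have "cfract c * y' + cfract r = cfract (c * s - d * r) * fract_X / (cfract c - cfract d * fract_X)"
    using nz by (simp add: y'_def field_simps)
  also have "cfract d * y' + cfract s = cfract (c * s - d * r) / (cfract c - cfract d * fract_X)"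
    using nz by (simp add: y'_def field_simps)
  finally have 2: "fract_subst y' y = fract_X" using nz ndet by simp
  have "bij (fract_subst y)"
    by (rule o_bij[of "fract_subst y'"])
      (auto simp: fun_eq_iff fract_subst_inverse nc 1 2)
  then show ?thesis
    using nc \<open>w \<noteq> 0\<close> w
    by (intro curve_isoI[of "fract_subst y" w])
      (simp_all add: fract_subst_add fract_subst_mult fract_subst_cfract fract_subst_poly)
qed

section \<open>The symmetric model\<close>

text \<open>Polymorphic because the formula is used over the complex numbers, as a curve, and over
  the rational function field, evaluated at \<open>fract_X\<close>.\<close>

definition symmetric_sextic :: "'a::comm_ring_1 \<Rightarrow> 'a \<Rightarrow> 'a poly" where
  "symmetric_sextic s1 s2 =
     (let t = s2^2 - 4 * s1^3;
          a0 = s2^2 + s1^2 * s2 - 2 * s1^3;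
          a1 = 2 * (s1^2 + 3 * s2) * (s2^2 - 4 * s1^3);
          a2 = (15 * s2^2 - s1^2 * s2 - 30 * s1^3) * (s2^2 - 4 * s1^3);
          a3 = 4 * (5 * s2 - s1^2) * (s2^2 - 4 * s1^3)^2
      in [:t^3 * a0, t^2 * a1, t * a2, a3, a2, a1, a0:])"

text \<open>The bracket is the even sextic at \<open>N / D\<close> with denominators cleared. Only
  even powers of \<open>N\<close> occur, so \<open>j\<close> contributes only signs, and the outer
  minus turns the leading coefficient into
  \<open>a ^ 6 + a ^ 5 * b ^ 2 + a ^ 2 * b ^ 5 + b ^ 6\<close>, which is \<open>a0\<close>.\<close>

lemma poly_symmetric_sextic:
  fixes a b x j r :: "'a::idom"
  assumes "j ^ 2 = - 1" and r: "r = a ^ 3 - b ^ 3"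
  defines "N \<equiv> j * a * (x + r)" and "D \<equiv> b * (x - r)"
  shows "poly (symmetric_sextic (a * b) (a ^ 3 + b ^ 3)) x =
     - (N ^ 6 - a * N ^ 4 * D ^ 2 + b * N ^ 2 * D ^ 4 - D ^ 6)"
proof -
  have j: "j ^ 4 = 1" "j ^ 6 = - 1"
    using assms(1) power_mult[of j 2 2] power_mult[of j 2 3] by simp_all
  have N: "N ^ 2 = - (a ^ 2 * (x + r) ^ 2)" "N ^ 4 = a ^ 4 * (x + r) ^ 4"
    "N ^ 6 = - (a ^ 6 * (x + r) ^ 6)"
    by (simp_all add: N_def power_mult_distrib j assms(1))
  have t: "(a ^ 3 + b ^ 3) ^ 2 - 4 * (a * b) ^ 3 = r ^ 2"
    unfolding r by Groebner_Basis.algebra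
  \<comment> \<open>Expanding in \<open>x\<close> gives odd coefficients that are an odd power of
    \<open>r\<close> times a form antisymmetric in \<open>a\<close> and \<open>b\<close>. That form
    is divisible by \<open>a ^ 3 - b ^ 3\<close>, the missing factor \<open>r\<close>. After these
    rewrites the goal is an identity with \<open>r\<close> as an independent variable.\<close>
  have a1: "2 * ((a * b)\<^sup>2 + 3 * (a ^ 3 + b ^ 3)) * r ^ 2
      = r * (6 * a ^ 6 + 2 * a ^ 5 * b ^ 2 - 2 * a ^ 2 * b ^ 5 - 6 * b ^ 6)"
    unfolding r by Groebner_Basis.algebra
  have a3: "4 * (5 * (a ^ 3 + b ^ 3) - (a * b)\<^sup>2) * (r\<^sup>2)\<^sup>2
      = r ^ 3 * (20 * a ^ 6 - 4 * a ^ 5 * b ^ 2 + 4 * a ^ 2 * b ^ 5 - 20 * b ^ 6)"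
    unfolding r by Groebner_Basis.algebra
  show ?thesis
    unfolding symmetric_sextic_def Let_def t a1 a3 N D_def
    by simp Groebner_Basis.algebra
qed

text \<open>
  At a double root, the chain rule and Euler's identity are two independent linear equations for the
  partial derivatives \<open>fx\<close> and \<open>fz\<close> of the homogenized even sextic, which must therefore vanish.
\<close>

lemma rsquarefree_symmetric_sextic:
  fixes a b :: complex
  assumes sqf: "rsquarefree (even_sextic a b)" and nz: "a \<noteq> 0" "b \<noteq> 0" "a ^ 3 \<noteq> b ^ 3"
  shows "rsquarefree (symmetric_sextic (a * b) (a ^ 3 + b ^ 3))" (is "rsquarefree ?g")
  unfolding rsquarefree_roots
proof (intro allI notI, elim conjE)
  fix z
  assume g0: "poly ?g z = 0" and g1: "poly (pderiv ?g) z = 0"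
  define r where "r = a ^ 3 - b ^ 3"
  define N where "N = [:\<i> * a * r, \<i> * a:]"
  define D where "D = [:- b * r, b:]"
  define n where "n = poly N z"
  define d where "d = poly D z"
  have g: "?g = - (N ^ 6 - [:a:] * N ^ 4 * D ^ 2 + [:b:] * N ^ 2 * D ^ 4 - D ^ 6)"
    by (rule poly_eq_poly_eq_iff[THEN iffD1], rule ext, subst poly_symmetric_sextic[OF power2_i r_def])
      (auto simp: N_def D_def algebra_simps)
  have e0: "n ^ 6 - a * n ^ 4 * d ^ 2 + b * n ^ 2 * d ^ 4 - d ^ 6 = 0"
    using g0 by (simp add: g n_def d_def)
  define fx where "fx = 6 * n ^ 5 - 4 * a * n ^ 3 * d ^ 2 + 2 * b * n * d ^ 4"
  define fz where "fz = - 2 * a * n ^ 4 * d + 4 * b * n ^ 2 * d ^ 3 - 6 * d ^ 5"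
  have e1: "fx * (\<i> * a) + fz * b = 0"
  proof -
    have "pderiv N = [:\<i> * a:]" "pderiv D = [:b:]" by (simp_all add: N_def D_def pderiv_pCons)
    then have "poly (pderiv ?g) z = - (fx * (\<i> * a) + fz * b)"
      by (simp add: g pderiv_diff pderiv_add pderiv_minus pderiv_mult pderiv_power pderiv_smult
          pderiv_pCons fx_def fz_def flip: n_def d_def)
        (simp add: algebra_simps eval_nat_numeral)
    with g1 show ?thesis by (metis neg_equal_0_iff_equal)
  qed
  have euler: "n * fx + d * fz = 0"
    using e0 unfolding fx_def fz_def by Groebner_Basis.algebra
  have det: "\<i> * a * d - b * n = - 2 * \<i> * a * b * r"
    by (simp add: n_def d_def N_def D_def algebra_simps)
  \<comment> \<open>Eliminates \<open>fz\<close>: \<open>d\<close> times \<open>e1\<close> minus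
    \<open>b\<close> times \<open>euler\<close>.\<close>
  have "(\<i> * a * d - b * n) * fx = 0"
    using e1 euler by Groebner_Basis.algebra
  then have fx0: "fx = 0" using nz by (simp add: det r_def)
  \<comment> \<open>If \<open>d = 0\<close>, the point lies over infinity, where the homogenized
    sextic is \<open>n ^ 6\<close>; but \<open>n\<close> and \<open>d\<close> cannot both vanish,
    because \<open>det\<close> is nonzero.\<close>
  show False
  proof (cases "d = 0")
    case True
    with e0 have "n = 0" by simp
    with True det nz show False by (simp add: r_def)
  next
    case False
    have "poly (even_sextic a b) (n / d) = 0"
      using e0 False by (simp add: even_sextic_def field_simps) Groebner_Basis.algebra
    \<comment> \<open>\<open>fx\<close> is \<open>d ^ 5\<close> times this derivative.\<close>
    moreover have "poly (pderiv (even_sextic a b)) (n / d) = 0"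
      using fx0 False by (simp add: even_sextic_def pderiv_pCons fx_def field_simps) Groebner_Basis.algebra
    ultimately show False using sqf by (auto simp: rsquarefree_roots)
  qed
qed

text \<open>By the symmetry of the coefficients, a sextic of degree below 5 would have a double root at 0.\<close>

lemma genus2_symmetric_sextic:
  assumes "rsquarefree (symmetric_sextic s1 s2)"
  shows "genus2_curve (symmetric_sextic s1 s2)"
  using assms
  by (auto simp: genus2_curve_def symmetric_sextic_def Let_def rsquarefree_roots pderiv_pCons
      dest!: spec[of _ 0])

lemma curve_iso_symmetric_sextic:
  fixes a b :: complex
  assumes nz: "a \<noteq> 0" "b \<noteq> 0" "a ^ 3 \<noteq> b ^ 3"
  shows "curve_iso (even_sextic a b) (symmetric_sextic (a * b) (a ^ 3 + b ^ 3))"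
    (is "curve_iso ?f ?g")
proof -
  define r where "r = a ^ 3 - b ^ 3"
  define A B J R where "A = cfract a" and "B = cfract b" and "J = cfract \<i>" and "R = cfract r"
  define N where "N = J * A * (fract_X + R)"
  define D where "D = B * (fract_X - R)"
  define y where "y = (cfract (\<i> * a) * fract_X + cfract (\<i> * a * r)) / (cfract b * fract_X + cfract (- b * r))"
  have "D \<noteq> 0"
    using nz by (auto simp: D_def B_def R_def cfract_def fract_X_def Zero_fract_def eq_fract)
  have J: "J ^ 2 = - 1"
    unfolding J_def by (simp flip: cfract_hom(7))
  have y: "y = N / D"
    by (simp add: y_def N_def D_def A_def B_def J_def R_def algebra_simps)
  \<comment> \<open>Moves the coefficients into the function field, so that the polynomial identity
    applies there with \<open>x = fract_X\<close>.\<close>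
  have g: "Fract ?g 1 = poly (symmetric_sextic (A * B) (A ^ 3 + B ^ 3)) fract_X"
    unfolding eval_fract_X[symmetric] symmetric_sextic_def Let_def
    by (simp add: A_def B_def del: eval_fract_X)
  have R: "R = A ^ 3 - B ^ 3" by (simp add: R_def r_def A_def B_def)
  have "eval_fract y ?f = y ^ 6 - A * y ^ 4 + B * y ^ 2 - 1"
    by (simp add: even_sextic_def A_def B_def algebra_simps eval_nat_numeral)
  also have "\<dots> = (N ^ 6 - A * N ^ 4 * D ^ 2 + B * N ^ 2 * D ^ 4 - D ^ 6) / D ^ 6"
    using \<open>D \<noteq> 0\<close> by (simp add: y field_simps)
  also have "\<dots> = - Fract ?g 1 / D ^ 6"
    unfolding g poly_symmetric_sextic[OF J R] N_def D_def by simp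
  \<comment> \<open>The sign is absorbed as \<open>J ^ 2\<close>, making the factor a square as the
    lift of Y requires.\<close>
  also have "\<dots> = (J / D ^ 3) ^ 2 * Fract ?g 1"
    by (simp add: power_divide J flip: power_mult del: minus_fract)
  finally have "eval_fract y ?f = (J / D ^ 3) ^ 2 * Fract ?g 1" .
  moreover have "J / D ^ 3 \<noteq> 0" using \<open>D \<noteq> 0\<close> by (simp add: J_def)
  moreover have "\<i> * a * (- b * r) \<noteq> b * (\<i> * a * r)"
    using nz by (simp add: r_def)
  ultimately show ?thesis
    unfolding y_def by (intro curve_iso_moebius[of "\<i> * a" "- b * r" b "\<i> * a * r"])
qed

theorem theorem3:
  fixes p :: "complex poly set" and s1 s2 :: complex
  assumes "p \<in> locus_L2"
    and "has_s_invariants p s1 s2"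
    and "s1 \<noteq> 0"
    and "s2^2 - 4 * s1^3 \<noteq> 0"
  shows "let t = s2^2 - 4 * s1^3;
             a0 = s2^2 + s1^2 * s2 - 2 * s1^3;
             a1 = 2 * (s1^2 + 3 * s2) * (s2^2 - 4 * s1^3);
             a2 = (15 * s2^2 - s1^2 * s2 - 30 * s1^3) * (s2^2 - 4 * s1^3);
             a3 = 4 * (5 * s2 - s1^2) * (s2^2 - 4 * s1^3)^2
         in \<exists>C. represents C p \<and>
                C = [:t^3 * a0, t^2 * a1, t * a2, a3, a2, a1, a0:]"
proof -
  obtain a b where rep: "represents (even_sextic a b) p" and s: "s1 = a * b" "s2 = a ^ 3 + b ^ 3"
    using assms(2) unfolding has_s_invariants_def by blast
  have "s2 ^ 2 - 4 * s1 ^ 3 = (a ^ 3 - b ^ 3) ^ 2"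
    unfolding s by Groebner_Basis.algebra
  with assms(3,4) s have nz: "a \<noteq> 0" "b \<noteq> 0" "a ^ 3 \<noteq> b ^ 3" by auto
  \<comment> \<open>Squarefreeness is part of \<open>represents\<close>; it transfers to the
    symmetric sextic, and the isomorphism identifies the two classes.\<close>
  have "rsquarefree (even_sextic a b)" "iso_class (even_sextic a b) = p"
    using rep by (simp_all add: represents_def genus2_curve_def)
  then have "represents (symmetric_sextic s1 s2) p"
    unfolding represents_def s
    using genus2_symmetric_sextic[OF rsquarefree_symmetric_sextic] iso_class_cong
      curve_iso_symmetric_sextic nz by blast
  then show ?thesis
    unfolding symmetric_sextic_def Let_def by blast
qed

end
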